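(* Let $t \in \mathbb{N}$ and let $k$ be an integer with $k \ge 5490 + 45t$. Let $G$ be a finite graph that contains none of the cycles $C_3, C_5, \dots, C_{2k-1}$ as a subgraph (i.e. $G$ has no odd cycle of length less than $2k+1$), and suppose that the minimum degree of $G$ is at least $\frac{1}{2k+t}|V(G)|$. Then $G$ is $3$-colourable. Equivalently, for all such $k$, $\delta_{\chi}(\mathcal{C}_{2k-1},3)\le \frac{1}{2k+t}$.
   Context: $\mathcal{C}_{2k-1}=\{C_3,C_5,\dots,C_{2k-1}\}$ denotes the family of odd cycles of length at most $2k-1$. For a finite family $\mathcal{H}$ of graphs and an integer $c\ge 2$, $\delta_\chi(\mathcal{H},c)$ is the infimum of all $\alpha\in[0,1]$ such that every graph $G$ containing no member of $\mathcal{H}$ as a subgraph and with minimum degree at least $\alpha|V(G)|$ satisfies $\chi(G)\le c$. *)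

theory Defs
  imports Complex_Main
begin

definition simple_graph :: "'a set \<Rightarrow> ('a \<Rightarrow> 'a \<Rightarrow> bool) \<Rightarrow> bool" where
  "simple_graph V E \<longleftrightarrow> finite V \<and> (\<forall>u v. E u v \<longrightarrow> u \<in> V \<and> v \<in> V)
     \<and> (\<forall>u v. E u v \<longrightarrow> E v u) \<and> (\<forall>v. \<not> E v v)"

definition has_cycle :: "'a set \<Rightarrow> ('a \<Rightarrow> 'a \<Rightarrow> bool) \<Rightarrow> nat \<Rightarrow> bool" where
  "has_cycle V E l \<longleftrightarrow> 3 \<le> l \<and> (\<exists>vs. length vs = l \<and> distinct vs \<and> set vs \<subseteq> V
     \<and> (\<forall>i<l. E (vs ! i) (vs ! ((i + 1) mod l))))"

definition degree :: "'a set \<Rightarrow> ('a \<Rightarrow> 'a \<Rightarrow> bool) \<Rightarrow> 'a \<Rightarrow> nat" where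
  "degree V E v = card {u \<in> V. E v u}"

definition colourable :: "'a set \<Rightarrow> ('a \<Rightarrow> 'a \<Rightarrow> bool) \<Rightarrow> nat \<Rightarrow> bool" where
  "colourable V E c \<longleftrightarrow> (\<exists>f :: 'a \<Rightarrow> nat. (\<forall>v\<in>V. f v < c)
     \<and> (\<forall>u\<in>V. \<forall>v\<in>V. E u v \<longrightarrow> f u \<noteq> f v))"

end

theory Submission
  imports Defs
begin

text \<open>
  A maximal set \<open>S\<close> of vertices with pairwise disjoint neighbourhoods has at most \<open>2 k + t\<close>
  elements, and every vertex is joined by a walk of length exactly 2 to some element of \<open>S\<close>.
  Hence the graph maps homomorphically to a graph on \<open>S\<close> whose edges are walks of length 5, so
  the odd girth of the latter is at least about \<open>2 k / 5\<close>, which is linear in \<open>card S\<close>.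

  Such a graph is 3-colourable (following Kierstead, Szemeredi and Trotter). Growing balls until
  their boundary is relatively small yields a small set \<open>W\<close> whose removal leaves a bipartite
  graph. Group the vertices of \<open>W\<close> into clusters by linking those at distance at most 3. Each
  cluster lies in a ball that is bipartite, and the even vertices of the cluster together with
  the neighbours of its odd vertices receive the third colour. The odd vertices of \<open>W\<close> are then
  isolated from all vertices not of the third colour.
\<close>

section \<open>Odd closed walks and odd girth\<close>

definition no_short_odd_walk :: "('a \<Rightarrow> 'a \<Rightarrow> bool) \<Rightarrow> nat \<Rightarrow> bool" where
  "no_short_odd_walk F L \<longleftrightarrow> (\<forall>x n. odd n \<and> n \<le> L \<longrightarrow> \<not> (F ^^ n) x x)"

lemma relpowp_sym:
  assumes "symp F" "(F ^^ n) x y"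
  shows "(F ^^ n) y x"
  using assms(2)
proof (induction n arbitrary: y)
  case (Suc n)
  then obtain z where "(F ^^ n) x z" "F z y" by (auto elim: relpowp_Suc_E)
  then show ?case using Suc.IH assms(1) by (meson relpowp_Suc_I2 sympD)
qed simp

lemma relpowp_trans: "(F ^^ m) x y \<Longrightarrow> (F ^^ n) y z \<Longrightarrow> (F ^^ (m + n)) x z"
  by (auto simp: relpowp_add)

lemma relpowp_subwalk:
  assumes "\<And>i. i < n \<Longrightarrow> F (f i) (f (Suc i))" "a \<le> b" "b \<le> n"
  shows "(F ^^ (b - a)) (f a) (f b)"
  unfolding relpowp_fun_conv
  by (rule exI[of _ "\<lambda>i. f (a + i)"]) (use assms in auto)

text \<open>The two walks and the edge close up to a walk of length \<open>a + b + 1\<close>, which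
  is odd. Hence in a ball of small radius the parity of walk lengths from the centre is a proper
  2-colouring.\<close>

lemma no_short_odd_walk_edge:
  assumes "symp F" "no_short_odd_walk F L" "(F ^^ a) r x" "(F ^^ b) r y" "even a = even b"
    "a + b < L"
  shows "\<not> F x y"
proof
  assume "F x y"
  then have "(F ^^ Suc a) r y" using assms(3) by auto
  then have "(F ^^ (Suc a + b)) r r"
    using relpowp_sym[OF assms(1,4)] relpowp_trans by metis
  then show False using assms(2,5,6) unfolding no_short_odd_walk_def
    by (metis Suc_leI add_Suc even_Suc even_add)
qed

text \<open>A shortest odd closed walk is a cycle: a repeated vertex would split it into two shorter
  closed walks, one of them odd. Closed walks are easier to glue and to transport than
  cycles.\<close>

lemma no_short_odd_walk_of_no_odd_cycle:
  assumes "simple_graph V E" "\<And>l. odd l \<Longrightarrow> 3 \<le> l \<Longrightarrow> l \<le> L \<Longrightarrow> \<not> has_cycle V E l"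
  shows "no_short_odd_walk E L"
proof (rule ccontr)
  assume "\<not> no_short_odd_walk E L"
  then have ex: "\<exists>n. odd n \<and> n \<le> L \<and> (\<exists>x. (E ^^ n) x x)"
    unfolding no_short_odd_walk_def by blast
  define n where "n = (LEAST n. odd n \<and> n \<le> L \<and> (\<exists>x. (E ^^ n) x x))"
  from LeastI_ex[OF ex, folded n_def] obtain x where n: "odd n" "n \<le> L" "(E ^^ n) x x" by blast
  have least: "\<not> (E ^^ m) y y" if "odd m" "m < n" for m y
    using not_less_Least[of m, folded n_def] that n(2) n_def by fastforce
  obtain f where f: "f 0 = x" "f n = x" "\<And>i. i < n \<Longrightarrow> E (f i) (f (Suc i))"
    using n(3) unfolding relpowp_fun_conv by blast
  have "f i \<noteq> f j" if ij: "i < j" "j < n" for i j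
  proof
    assume eq: "f i = f j"
    have w1: "(E ^^ (j - i)) (f i) (f i)" using relpowp_subwalk[of n E f i j] f(3) ij eq by simp
    have "(E ^^ (i - 0)) (f 0) (f i)" "(E ^^ (n - j)) (f j) (f n)"
      using relpowp_subwalk[of n E f 0 i] relpowp_subwalk[of n E f j n] f(3) ij by auto
    then have w2: "(E ^^ (i + (n - j))) x x" using relpowp_trans[of i E x "f i"] eq f by simp
    show False
    proof (cases "odd (j - i)")
      case True
      then show False using least[of "j - i"] w1 ij by auto
    next
      case False
      then have "odd (i + (n - j))" using n(1) ij by simp
      then show False using least w2 ij by simp
    qed
  qed
  then have inj: "inj_on f {..<n}" by (metis inj_onI lessThan_iff linorder_neqE_nat)
  have "n \<noteq> 1" using n(3) assms(1) unfolding simple_graph_def by auto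
  then have n3: "3 \<le> n" using n(1) by (cases n; cases "n - 1"; cases "n - 2") auto
  have "has_cycle V E n" unfolding has_cycle_def
  proof (intro conjI exI[of _ "map f [0..<n]"] allI impI)
    show "distinct (map f [0..<n])" using inj by (simp add: distinct_map atLeast0LessThan)
    show "set (map f [0..<n]) \<subseteq> V"
      using f(3) assms(1) unfolding simple_graph_def by (force simp del: upt_Suc)
    fix i assume i: "i < n"
    show "E (map f [0..<n] ! i) (map f [0..<n] ! ((i + 1) mod n))"
      using i f(1,2) f(3)[of i] by (cases "Suc i = n") auto
  qed (use n3 in auto)
  then show False using assms(2) n n3 by blast
qed

section \<open>Sparse odd cycle transversals by ball growing\<close>

lemma small_boundary_radius:
  fixes B :: "nat \<Rightarrow> 'a set"
  assumes "\<And>i. finite (B i)" "B 0 \<noteq> {}" "\<And>i. B i \<subseteq> B (Suc i)" "card (B R) \<le> N"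
    "N * q ^ R < (q + 1) ^ R"
  obtains i where "i < R" "q * card (B (Suc i) - B i) \<le> card (B i)"
proof (rule ccontr)
  assume "\<not> thesis"
  \<comment> \<open>If every boundary is large, each step multiplies the ball by more than
    \<open>(q + 1) / q\<close>, so \<open>R\<close> steps from a nonempty ball exceed
    \<open>N\<close>.\<close>
  with that have grow: "q * card (B (Suc i) - B i) > card (B i)" if "i < R" for i
    using \<open>i < R\<close> by (meson not_le)
  have "(q + 1) ^ i \<le> q ^ i * card (B i)" if "i \<le> R" for i
    using that
  proof (induction i)
    case 0
    then show ?case using assms(1,2) by (simp add: Suc_le_eq card_gt_0_iff)
  next
    case (Suc i)
    have "card (B (Suc i)) = card (B i) + card (B (Suc i) - B i)"
      using assms(1,3) by (metis card_Diff_subset card_mono le_add_diff_inverse)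
    then have "(q + 1) * card (B i) \<le> q * card (B (Suc i))"
      using grow[of i] Suc.prems by (simp add: algebra_simps)
    then have "q ^ i * ((q + 1) * card (B i)) \<le> q ^ i * (q * card (B (Suc i)))"
      by (rule mult_le_mono2)
    moreover have "(q + 1) * (q + 1) ^ i \<le> (q + 1) * (q ^ i * card (B i))"
      using Suc by (intro mult_le_mono2) simp
    ultimately show ?case by (simp only: power_Suc mult_ac)
  qed
  from this[of R] have "(q + 1) ^ R \<le> N * q ^ R"
    using assms(4) by (metis le_refl le_trans mult.commute mult_le_mono1)
  then show False using assms(5) by simp
qed

text \<open>Cut out a ball whose boundary has at most a \<open>1 / q\<close> fraction of its size,
  put the boundary into \<open>W\<close>, and recurse on the rest. The balls are disjoint, so the
  charges add up to at most \<open>card A / q\<close>.\<close>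

lemma small_odd_cycle_transversal:
  fixes F :: "'a \<Rightarrow> 'a \<Rightarrow> bool"
  assumes "symp F" "no_short_odd_walk F L" "2 * R \<le> L" "N * q ^ R < (q + 1) ^ R"
  shows "finite A \<Longrightarrow> card A \<le> N \<Longrightarrow> \<exists>W \<subseteq> A. q * card W \<le> card A \<and>
    (\<exists>c :: 'a \<Rightarrow> bool. \<forall>x \<in> A - W. \<forall>y \<in> A - W. F x y \<longrightarrow> c x \<noteq> c y)"
proof (induction "card A" arbitrary: A rule: less_induct)
  case less
  show ?case
  proof (cases "A = {}")
    case False
    then obtain v where v: "v \<in> A" by blast
    \<comment> \<open>Balls grow inside \<open>A\<close> only, which keeps them disjoint from those
      cut out earlier; their walks are still \<open>F\<close>-walks, so the odd girth
      applies.\<close>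
    define FA where "FA = (\<lambda>x y. F x y \<and> x \<in> A \<and> y \<in> A)"
    define B where "B i = {x. \<exists>a\<le>i. (FA ^^ a) v x}" for i
    have FA_walk: "(F ^^ a) v x \<and> x \<in> A" if "(FA ^^ a) v x" for a x
      using that
    proof (induction a arbitrary: x)
      case (Suc a)
      then obtain z where "(FA ^^ a) v z" "FA z x" by (auto elim: relpowp_Suc_E)
      with Suc.IH[of z] show ?case by (auto simp: FA_def)
    qed (use v in auto)
    have BA: "B i \<subseteq> A" for i using FA_walk by (auto simp: B_def)
    have fin: "finite (B i)" for i using BA less.prems(1) finite_subset by blast
    have v0: "v \<in> B i" for i unfolding B_def by (auto intro!: exI[of _ 0])
    have mono: "B i \<subseteq> B (Suc i)" for i unfolding B_def using le_Suc_eq by auto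
    have step: "y \<in> B (Suc i)" if xy: "x \<in> B i" "F x y" "y \<in> A" for x y i
    proof -
      obtain a where a: "a \<le> i" "(FA ^^ a) v x" using xy(1) by (auto simp: B_def)
      moreover have "FA x y" using xy BA by (auto simp: FA_def)
      ultimately have "(FA ^^ Suc a) v y" by auto
      with a(1) show ?thesis unfolding B_def by blast
    qed
    have "card (B R) \<le> N" using BA less.prems by (meson card_mono le_trans)
    then obtain i where i: "i < R" "q * card (B (Suc i) - B i) \<le> card (B i)"
      using small_boundary_radius[of B R N q] fin v0 mono assms(4) by blast
    define A' where "A' = A - B (Suc i)"
    have card_A: "card A = card A' + card (B (Suc i))"
      unfolding A'_def using BA fin less.prems(1)
      by (metis card_Diff_subset card_mono le_add_diff_inverse2)
    have "card (B (Suc i)) > 0" using fin v0 card_gt_0_iff by blast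
    then have "card A' < card A" "finite A'" "card A' \<le> N"
      using card_A less.prems by (simp_all add: A'_def)
    from less.hyps[OF this]
    obtain W' and c :: "'a \<Rightarrow> bool" where W': "W' \<subseteq> A'" "q * card W' \<le> card A'"
      "\<forall>x \<in> A' - W'. \<forall>y \<in> A' - W'. F x y \<longrightarrow> c x \<noteq> c y"
      by blast
    define W where "W = W' \<union> (B (Suc i) - B i)"
    define c' where "c' x = (if x \<in> B i then \<exists>a\<le>i. even a \<and> (FA ^^ a) v x else c x)" for x
    have "card W \<le> card W' + card (B (Suc i) - B i)" unfolding W_def by (rule card_Un_le)
    then have "q * card W \<le> q * card W' + q * card (B (Suc i) - B i)"
      by (metis add_mult_distrib2 mult_le_mono2)
    also have "\<dots> \<le> card A' + card (B (Suc i))"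
      using W'(2) i(2) card_mono[OF fin mono, of i] by linarith
    finally have "q * card W \<le> card A" using card_A by simp
    moreover have "W \<subseteq> A" using W'(1) BA unfolding W_def A'_def by blast
    moreover have "c' x \<noteq> c' y" if xy: "x \<in> A - W" "y \<in> A - W" "F x y" for x y
    proof -
      have yx: "F y x" using xy(3) assms(1) by (rule sympD[rotated])
      have split: "z \<in> B i \<or> z \<in> A' - W'" if "z \<in> A - W" for z
        using that unfolding W_def A'_def by blast
      \<comment> \<open>Deleting the boundary separates the ball from the rest, so the two
        colourings never meet along an edge.\<close>
      have same: "x \<in> B i \<longleftrightarrow> y \<in> B i"
        using step[of x i y] step[of y i x] xy yx unfolding W_def by blast
      show ?thesis
      proof (cases "x \<in> B i")
        case True
        show ?thesis
        proof
          assume eq: "c' x = c' y"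
          \<comment> \<open>Equal colours mean walks of equal parity, with \<open>a + b\<close> at
            most \<open>2 * i\<close>, which is below \<open>L\<close>.\<close>
          obtain a b where "a \<le> i" "(FA ^^ a) v x" "b \<le> i" "(FA ^^ b) v y" "even a = even b"
          proof (cases "c' x")
            case True
            with eq \<open>x \<in> B i\<close> same that show ?thesis unfolding c'_def by auto
          next
            case False
            from \<open>x \<in> B i\<close> same obtain a b
              where ab: "a \<le> i" "(FA ^^ a) v x" "b \<le> i" "(FA ^^ b) v y"
              unfolding B_def by blast
            with False eq \<open>x \<in> B i\<close> same have "odd a" "odd b" unfolding c'_def by auto
            with ab that show ?thesis by blast
          qed
          with no_short_odd_walk_edge[OF assms(1,2), of a v x b y] FA_walk xy(3) i(1) assms(3)
          show False by auto
        qed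
      next
        case False
        with same split xy W'(3) show ?thesis unfolding c'_def by auto
      qed
    qed
    ultimately show ?thesis by blast
  qed simp
qed

section \<open>Three-colouring from a transversal\<close>

lemma relpowp_bounded_card:
  assumes "finite W" "\<And>x y. P x y \<Longrightarrow> x \<in> W" "P\<^sup>*\<^sup>* r w" "w \<in> W"
  obtains n where "n < card W" "(P ^^ n) r w"
proof -
  have ex: "\<exists>n. (P ^^ n) r w" using assms(3) by (simp add: rtranclp_is_Sup_relpowp)
  define n where "n = (LEAST n. (P ^^ n) r w)"
  have n: "(P ^^ n) r w" using LeastI_ex[OF ex] n_def by simp
  have least: "\<not> (P ^^ m) r w" if "m < n" for m using that not_less_Least n_def by blast
  obtain f where f: "f 0 = r" "f n = w" "\<And>i. i < n \<Longrightarrow> P (f i) (f (Suc i))"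
    using n unfolding relpowp_fun_conv by blast
  have "f i \<noteq> f j" if ij: "i < j" "j \<le> n" for i j
  proof
    assume "f i = f j"
    moreover have "(P ^^ (i - 0)) (f 0) (f i)" "(P ^^ (n - j)) (f j) (f n)"
      using relpowp_subwalk[of n P f 0 i] relpowp_subwalk[of n P f j n] f(3) ij by auto
    ultimately have "(P ^^ (i + (n - j))) r w" using relpowp_trans[of i P r "f i"] f by simp
    then show False using least ij by simp
  qed
  then have "inj_on f {..n}" by (metis inj_onI atMost_iff linorder_neqE_nat)
  moreover have "f ` {..n} \<subseteq> W"
  proof safe
    fix i assume "i \<le> n"
    \<comment> \<open>The hypothesis on \<open>P\<close> places only tails of steps in
      \<open>W\<close>; the final vertex is covered by \<open>w \<in> W\<close>.\<close>
    then show "f i \<in> W" using f(2) f(3)[of i] assms(2)[of "f i"] assms(4) by (cases "i = n") auto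
  qed
  ultimately have "card {..n} \<le> card W" using assms(1) by (metis card_inj_on_le)
  then show thesis using n by (intro that[of n]) auto
qed

lemma three_colouring_from_transversal:
  fixes F :: "'a \<Rightarrow> 'a \<Rightarrow> bool" and c :: "'a \<Rightarrow> bool"
  assumes "symp F" "no_short_odd_walk F L" "finite W" "6 * card W \<le> L"
    and bip: "\<And>x y. x \<in> S - W \<Longrightarrow> y \<in> S - W \<Longrightarrow> F x y \<Longrightarrow> c x \<noteq> c y"
  shows "colourable S F 3"
proof -
  define P where "P = (\<lambda>x y. x \<in> W \<and> y \<in> W \<and> (\<exists>a\<le>3. (F ^^ a) x y))"
  \<comment> \<open>The choice depends only on the set of vertices that reach \<open>w\<close>, so
    it is constant on clusters.\<close>
  define root where "root w = (SOME r. P\<^sup>*\<^sup>* r w)" for w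
  define M where "M = 3 * (card W - 1)"
  have "symp P" using relpowp_sym[OF assms(1)] unfolding P_def by (intro sympI) blast
  then have symP: "P\<^sup>*\<^sup>* x y \<longleftrightarrow> P\<^sup>*\<^sup>* y x" for x y
    by (meson sympD symp_rtranclp)
  have root_eq: "root w = root w'" if "P w w'" for w w'
  proof -
    have "P\<^sup>*\<^sup>* r w \<longleftrightarrow> P\<^sup>*\<^sup>* r w'" for r
      using that symP[of w w'] by (meson r_into_rtranclp rtranclp_trans)
    then show ?thesis unfolding root_def by simp
  qed
  have P_walk: "\<exists>a\<le>3 * n. (F ^^ a) x y" if "(P ^^ n) x y" for n x y
    using that
  proof (induction n arbitrary: y)
    case (Suc n)
    then obtain z where z: "(P ^^ n) x z" "P z y" by (auto elim: relpowp_Suc_E)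
    then obtain a b where "a \<le> 3 * n" "(F ^^ a) x z" "b \<le> 3" "(F ^^ b) z y"
      using Suc.IH[of z] unfolding P_def by blast
    then have "a + b \<le> 3 * Suc n \<and> (F ^^ (a + b)) x y" using relpowp_trans by fastforce
    then show ?case by blast
  qed simp
  have root_walk: "\<exists>a\<le>M. (F ^^ a) (root w) w" if w: "w \<in> W" for w
  proof -
    have "P\<^sup>*\<^sup>* (root w) w" unfolding root_def by (rule someI[of _ w]) simp
    moreover have "x \<in> W" if "P x y" for x y using that unfolding P_def by blast
    ultimately obtain n where n: "n < card W" "(P ^^ n) (root w) w"
      using relpowp_bounded_card[of W P "root w" w] assms(3) w by metis
    then obtain a where "a \<le> 3 * n" "(F ^^ a) (root w) w" using P_walk by blast
    with n(1) show ?thesis unfolding M_def by (intro exI[of _ a]) auto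
  qed
  define ev where "ev w \<longleftrightarrow> (\<exists>a\<le>M. even a \<and> (F ^^ a) (root w) w)" for w
  \<comment> \<open>The third colour class. Each of its vertices is within distance 1 of
    \<open>W\<close> and is reached from a root by an even walk of length at most
    \<open>M + 1\<close>.\<close>
  define X where "X = {w \<in> W. ev w} \<union> {x. \<exists>w\<in>W. \<not> ev w \<and> F w x}"
  have X_walk: "\<exists>w\<in>W. \<exists>d\<le>1. (F ^^ d) w x \<and> (\<exists>a\<le>M + 1. even a \<and> (F ^^ a) (root w) x)"
    if x: "x \<in> X" for x
  proof (cases "x \<in> W \<and> ev x")
    case True
    then obtain a where "a \<le> M" "even a" "(F ^^ a) (root x) x" unfolding ev_def by blast
    then show ?thesis using True by (intro bexI[of _ x] exI[of _ 0]) (auto intro!: exI[of _ a])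
  next
    case False
    then obtain w where w: "w \<in> W" "\<not> ev w" "F w x" using x unfolding X_def by blast
    then obtain a where a: "a \<le> M" "(F ^^ a) (root w) w" using root_walk by blast
    then have "odd a" using w(2) unfolding ev_def by blast
    moreover have "(F ^^ Suc a) (root w) x" using a w(3) by auto
    ultimately have "\<exists>a\<le>M + 1. even a \<and> (F ^^ a) (root w) x"
      using a(1) by (intro exI[of _ "Suc a"]) simp
    moreover have "(F ^^ 1) w x" using w(3) by (simp add: eq_OO)
    ultimately show ?thesis using w(1) by blast
  qed
  have X_indep: "\<not> F x y" if xy: "x \<in> X" "y \<in> X" for x y
  proof
    assume F: "F x y"
    from X_walk[OF xy(1)] obtain w d a where w: "w \<in> W" "d \<le> 1" "(F ^^ d) w x"
      "a \<le> M + 1" "even a" "(F ^^ a) (root w) x" by blast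
    from X_walk[OF xy(2)] obtain w' d' a' where w': "w' \<in> W" "d' \<le> 1" "(F ^^ d') w' y"
      "a' \<le> M + 1" "even a'" "(F ^^ a') (root w') y" by blast
    have "(F ^^ Suc d) w y" using w(3) F by auto
    then have "(F ^^ (Suc d + d')) w w'"
      using relpowp_sym[OF assms(1) w'(3)] relpowp_trans by metis
    \<comment> \<open>This is why clusters link at distance 3: adjacent vertices of \<open>X\<close>
      belong to one cluster and share a root.\<close>
    moreover have "Suc d + d' \<le> 3" using w(2) w'(2) by simp
    ultimately have "P w w'" using w(1) w'(1) unfolding P_def by blast
    then have "root w' = root w" using root_eq by simp
    moreover have "card W > 0" using w(1) assms(3) card_gt_0_iff by blast
    \<comment> \<open>The sum is at most \<open>2 * (M + 1) = 6 * card W - 4\<close>.\<close>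
    then have "a + a' < L" using w(4) w'(4) assms(4) unfolding M_def by linarith
    ultimately show False
      using no_short_odd_walk_edge[OF assms(1,2) w(6), of a' y] w'(5,6) w(5) F by simp
  qed
  define f :: "'a \<Rightarrow> nat"
    where "f x = (if x \<in> X then 2 else if x \<in> W then 0 else of_bool (c x))" for x
  \<comment> \<open>A vertex of \<open>W\<close> outside \<open>X\<close> is odd, so all its
    neighbours have colour 2 and colour 0 is safe for it.\<close>
  have odd_nbr: "y \<in> X" if "x \<in> W" "x \<notin> X" "F x y" for x y
    using that unfolding X_def by blast
  have "f x \<noteq> f y" if "x \<in> S" "y \<in> S" "F x y" for x y
  proof -
    have "F y x" using that(3) assms(1) by (rule sympD[rotated])
    then show ?thesis
      using X_indep[of x y] odd_nbr[of x y] odd_nbr[of y x] bip[of x y] that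
      unfolding f_def by (auto split: if_splits simp: of_bool_def)
  qed
  moreover have "f x < 3" for x unfolding f_def by auto
  ultimately show ?thesis unfolding colourable_def by blast
qed

lemma three_colourable_of_large_odd_girth:
  assumes "finite S" "symp F" "no_short_odd_walk F L" "2 * R \<le> L"
    "card S * q ^ R < (q + 1) ^ R" "6 * card S \<le> q * L" "0 < q"
  shows "colourable S F 3"
proof -
  obtain W c where W: "W \<subseteq> S" "q * card W \<le> card S"
    "\<forall>x \<in> S - W. \<forall>y \<in> S - W. F x y \<longrightarrow> c x \<noteq> (c y :: bool)"
    using small_odd_cycle_transversal[OF assms(2-5) assms(1)] by blast
  have "q * (6 * card W) \<le> q * L" using W(2) assms(6) by linarith
  then have "6 * card W \<le> L" using assms(7) by simp
  then show ?thesis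
    using three_colouring_from_transversal[OF assms(2,3), of W S c] W(1,3) assms(1) finite_subset
    by blast
qed

section \<open>Reduction to a graph on few vertices\<close>

lemma linear_less_power_two:
  assumes "33 \<le> (j::nat)"
  shows "340 * (j + 1) < 2 ^ j"
  using assms by (induction j rule: dec_induct) auto

text \<open>A vertex violating the last clause could be added to a maximal \<open>S\<close>. It is
  really new, since its nonempty neighbourhood meets itself.\<close>

lemma maximal_disjoint_neighbourhoods:
  assumes "finite V" "\<And>v. v \<in> V \<Longrightarrow> N v \<noteq> {}"
  shows "\<exists>S \<subseteq> V. (\<forall>s\<in>S. \<forall>s'\<in>S. s \<noteq> s' \<longrightarrow> N s \<inter> N s' = {}) \<and>
    (\<forall>v\<in>V. \<exists>s\<in>S. N v \<inter> N s \<noteq> {})"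
proof -
  define Q where "Q S \<longleftrightarrow> S \<subseteq> V \<and> (\<forall>s\<in>S. \<forall>s'\<in>S. s \<noteq> s' \<longrightarrow> N s \<inter> N s' = {})" for S
  have "finite {S. Q S}"
    by (rule finite_subset[of _ "Pow V"]) (auto simp: Q_def assms(1))
  moreover have "{} \<in> {S. Q S}" unfolding Q_def by simp
  ultimately obtain S where S: "Q S" and max: "\<And>T. Q T \<Longrightarrow> S \<subseteq> T \<Longrightarrow> S = T"
    using finite_has_maximal[of "{S. Q S}"] by auto
  have "\<exists>s\<in>S. N v \<inter> N s \<noteq> {}" if v: "v \<in> V" for v
  proof (rule ccontr)
    assume *: "\<not> (\<exists>s\<in>S. N v \<inter> N s \<noteq> {})"
    then have "Q (insert v S)" using S v unfolding Q_def by blast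
    then have "v \<in> S" using max[of "insert v S"] by blast
    with * assms(2)[OF v] show False by blast
  qed
  with S show ?thesis unfolding Q_def by blast
qed

theorem theorem1p1:
  fixes V :: "'a set" and E :: "'a \<Rightarrow> 'a \<Rightarrow> bool" and t k :: nat
  assumes "k \<ge> 5490 + 45 * t"
    and "simple_graph V E"
    and "\<forall>l. odd l \<and> 3 \<le> l \<and> l \<le> 2 * k - 1 \<longrightarrow> \<not> has_cycle V E l"
    and "\<forall>v\<in>V. real (degree V E v) \<ge> real (card V) / real (2 * k + t)"
  shows "colourable V E 3"
proof (cases "V = {}")
  case True
  then show ?thesis unfolding colourable_def by simp
next
  case False
  have finV: "finite V" and EV: "\<And>u v. E u v \<Longrightarrow> u \<in> V \<and> v \<in> V" and symE: "symp E"
    using assms(2) unfolding simple_graph_def by (auto intro: sympI)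
  have odd_girth: "no_short_odd_walk E (2 * k - 1)"
    using no_short_odd_walk_of_no_odd_cycle assms(2,3) by blast
  have n_pos: "card V > 0" using False finV card_gt_0_iff by blast
  define N where "N v = {u \<in> V. E v u}" for v
  have finN: "finite (N v)" for v using finV unfolding N_def by simp
  have deg: "card V \<le> card (N v) * (2 * k + t)" if "v \<in> V" for v
  proof -
    have "real (card V) \<le> real (card (N v)) * real (2 * k + t)"
      using assms(4) that assms(1) unfolding degree_def N_def by (simp add: field_simps)
    then show ?thesis by (metis of_nat_le_iff of_nat_mult)
  qed
  have "N v \<noteq> {}" if "v \<in> V" for v using n_pos deg[OF that] by auto
  then have "\<exists>S \<subseteq> V. (\<forall>s\<in>S. \<forall>s'\<in>S. s \<noteq> s' \<longrightarrow> N s \<inter> N s' = {}) \<and>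
    (\<forall>v\<in>V. \<exists>s\<in>S. N v \<inter> N s \<noteq> {})"
    by (rule maximal_disjoint_neighbourhoods[OF finV])
  then obtain S where S: "S \<subseteq> V" "\<forall>s\<in>S. \<forall>s'\<in>S. s \<noteq> s' \<longrightarrow> N s \<inter> N s' = {}"
    "\<forall>v\<in>V. \<exists>s\<in>S. N v \<inter> N s \<noteq> {}"
    by blast
  have finS: "finite S" using S(1) finV finite_subset by blast
  have card_S: "card S \<le> 2 * k + t"
  proof -
    \<comment> \<open>Disjoint neighbourhoods, each of size at least
      \<open>card V / (2 * k + t)\<close>, are packed into \<open>V\<close>.\<close>
    have "card S * card V \<le> (\<Sum>s\<in>S. card (N s) * (2 * k + t))"
      using sum_mono[of S "\<lambda>_. card V" "\<lambda>s. card (N s) * (2 * k + t)"] deg S(1) by auto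
    also have "\<dots> = card (\<Union>s\<in>S. N s) * (2 * k + t)"
      using card_UN_disjoint[of S N] finS finN S(2) by (simp add: sum_distrib_right)
    also have "\<dots> \<le> card V * (2 * k + t)"
      using card_mono[OF finV, of "\<Union>s\<in>S. N s"] unfolding N_def by auto
    finally show ?thesis using n_pos by (simp add: mult.commute)
  qed
  obtain \<phi> where \<phi>: "\<And>v. v \<in> V \<Longrightarrow> \<phi> v \<in> S" "\<And>v. v \<in> V \<Longrightarrow> N v \<inter> N (\<phi> v) \<noteq> {}"
    using S(3) by metis
  have walk2: "(E ^^ 2) (\<phi> v) v" if v: "v \<in> V" for v
  proof -
    obtain x where "E v x" "E (\<phi> v) x" using \<phi>(2)[OF v] unfolding N_def by blast
    then show ?thesis using sympD[OF symE] by (auto simp: numeral_2_eq_2)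
  qed
  \<comment> \<open>The image of \<open>E\<close> under \<open>\<phi>\<close>, so that colourings of
    \<open>S\<close> pull back to \<open>V\<close>. Possible loops are excluded below by the odd
    girth of \<open>F\<close>.\<close>
  define F where "F s s' \<longleftrightarrow> (\<exists>u v. E u v \<and> \<phi> u = s \<and> \<phi> v = s')" for s s'
  have symF: "symp F" unfolding F_def using sympD[OF symE] by (intro sympI) blast
  have F_walk: "(E ^^ 5) s s'" if F: "F s s'" for s s'
  proof -
    obtain u v where uv: "E u v" "\<phi> u = s" "\<phi> v = s'" using F unfolding F_def by blast
    then have "(E ^^ 2) s u" "(E ^^ 2) v s'"
      using walk2 EV relpowp_sym[OF symE] by blast+
    moreover have "(E ^^ 1) u v" using uv(1) by (simp add: eq_OO)
    ultimately have "(E ^^ (2 + 1 + 2)) s s'" by (blast intro: relpowp_trans)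
    then show ?thesis by simp
  qed
  have F_walks: "(E ^^ (5 * n)) s s'" if "(F ^^ n) s s'" for n s s'
    using that
  proof (induction n arbitrary: s')
    case (Suc n)
    then obtain z where z: "(F ^^ n) s z" "F z s'" by (auto elim: relpowp_Suc_E)
    then have "(E ^^ (5 * n + 5)) s s'" using Suc.IH F_walk relpowp_trans by metis
    then show ?case by (simp add: add.commute)
  qed simp
  \<comment> \<open>An \<open>F\<close>-step is an \<open>E\<close>-walk of length 2 + 1 + 2, and
    multiplication by 5 preserves oddness.\<close>
  define L where "L = (2 * k - 1) div 5"
  have F_girth: "no_short_odd_walk F L"
    unfolding no_short_odd_walk_def
  proof (intro allI impI notI)
    fix x n assume "odd n \<and> n \<le> L" "(F ^^ n) x x"
    moreover from this have "odd (5 * n)" "5 * n \<le> 2 * k - 1" unfolding L_def by auto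
    ultimately show False using F_walks odd_girth unfolding no_short_odd_walk_def by blast
  qed
  \<comment> \<open>The radius will be \<open>32 * j\<close>, which needs
    \<open>64 * j \<le> L\<close> with \<open>L\<close> about \<open>2 * k / 5\<close>. This asks
    for \<open>k\<close> about \<open>160 * j\<close>; 165 absorbs the rounding.\<close>
  define j where "j = k div 165"
  have j: "33 \<le> j" "165 * j \<le> k" "k < 165 * (j + 1)"
    using assms(1) dividend_less_times_div[of 165 k] unfolding j_def by auto
  have L: "2 * k \<le> 5 * L + 5" unfolding L_def by linarith
  \<comment> \<open>As \<open>45 * t \<le> k\<close>, \<open>card S\<close> is at most
    \<open>91 * k / 45\<close>, hence below \<open>340 * (j + 1)\<close>.\<close>
  have "card S < 2 ^ j"
    using linear_less_power_two[OF j(1)] card_S assms(1) j(3) by linarith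
  \<comment> \<open>By Bernoulli, 32 growth steps with ratio 33/32 at least double the size.\<close>
  moreover have "(2::nat) ^ j * 32 ^ (32 * j) \<le> (32 + 1) ^ (32 * j)"
  proof -
    have "(2::nat) * 32 ^ 32 \<le> 33 ^ 32" by simp
    then have "((2::nat) * 32 ^ 32) ^ j \<le> (33 ^ 32) ^ j" by (rule power_mono) simp
    then show ?thesis by (simp only: power_mult power_mult_distrib) simp
  qed
  ultimately have "card S * 32 ^ (32 * j) < (32 + 1) ^ (32 * j)"
    by (meson less_le_trans mult_less_mono1 zero_less_numeral zero_less_power)
  moreover have "2 * (32 * j) \<le> L" using L j assms(1) by linarith
  \<comment> \<open>This fixes \<open>q = 32\<close>: the left side is at most
    \<open>12 * k + 6 * t\<close>, the right about \<open>12.8 * k\<close>.\<close>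
  moreover have "6 * card S \<le> 32 * L" using L card_S assms(1) by linarith
  ultimately have "colourable S F 3"
    using three_colourable_of_large_odd_girth[OF finS symF F_girth, of "32 * j" 32] by simp
  then obtain f :: "'a \<Rightarrow> nat" where f: "\<forall>s\<in>S. f s < 3" "\<forall>s\<in>S. \<forall>s'\<in>S. F s s' \<longrightarrow> f s \<noteq> f s'"
    unfolding colourable_def by blast
  have "f (\<phi> u) \<noteq> f (\<phi> v)" if "E u v" for u v
    using f(2) \<phi>(1) EV[OF that] that unfolding F_def by blast
  then show ?thesis
    unfolding colourable_def using f(1) \<phi>(1) by (intro exI[of _ "\<lambda>v. f (\<phi> v)"]) blast
qed

end
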